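(* Let $\langle v_i\rangle_{i\ge1}$ and $\langle\pi_i\rangle_{i\ge0}$ be the sequences generated by DPI or by IPI, starting from an admissible policy $\pi_0$ and under the boundary condition that, for every $i\in\mathbb N$, if $\pi_{i-1}$ is admissible then $\lim_{t\to\infty}\mathbb G_{\pi_{i-1}}^x[\gamma^tv_i(X_t)]=0$ for all $x\in\mathcal X$. Let $\mathcal T:\mathcal V_{\mathsf a}\to\mathcal V_{\mathsf a}$ be the associated policy iteration operator, and assume that $\mathcal T$ has a unique fixed point $v^*\in\mathcal V_{\mathsf a}$. Then there exists a metric $d:\mathcal V_{\mathsf a}\times\mathcal V_{\mathsf a}\to[0,\infty)$ such that $\mathcal T$ is a contraction (and thus continuous) under $d$ and $v_i\to v^*$ in the metric $d$.
   Context: State space $\mathcal X=\mathbb R^l$, $\mathcal X^{\mathsf T}=\mathbb R^{1\times l}$, time space $\mathbb T=[0,\infty)$. The action space $\mathcal U\subseteq\mathbb R^m$ is an $m$-dimensional manifold with or without boundary, meaning $\mathcal U=O\cup\partial O$ or $\mathcal U=O$ for some open $O\subseteq\mathbb R^m$. The environment is $\dot X_t=f(X_t,U_t)$, with $f:\mathcal X\times\mathcal U\to\mathcal X$ continuous and $t\mapsto U_t\in\mathcal U$ continuous; it is a standing assumption that the state trajectory $t\mapsto X_t$ is uniquely defined over all of $\mathbb T$ (for every initial state, in particular under every policy). A policy is a continuous function $\pi:\mathcal X\to\mathcal U$. $\mathbb G_\pi^x[Y]$ denotes the value of $Y$ when $X_0=x$ and $U_t=\pi(X_t)$ for all $t\in\mathbb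 T$. The reward function $r:\mathcal X\times\mathcal U\to\mathbb R$ is continuous, $R_t=r(X_t,U_t)$; $\gamma\in(0,1]$ is the discount factor and $\alpha=-\ln\gamma\ge0$. Standing assumption: $r$ attains a maximum $r_{\mathsf{max}}$, and $r_{\mathsf{max}}=0$ if $\gamma=1$. The value function (VF) of $\pi$ is $v_\pi(x)=\mathbb G_\pi^x[\int_0^\infty\gamma^tR_t\,dt]\in[-\infty,\infty)$. A policy $\pi$ (and its VF) is admissible iff $v_\pi(x)$ is finite for all $x\in\mathcal X$; $\Pi_{\mathsf a}$, $\mathcal V_{\mathsf a}$ are the sets of admissible policies and admissible VFs. Standing assumption: at least one admissible policy exists, and every admissible VF is $\mathrm C^1$. Gradients are row vectors, and the Hamiltonian is $h(x,u,p)=r(x,u)+p\,f(x,u)$. Standing assumption: there is a continuous $u_*:\mathcal X\times\mathcal X^{\mathsf T}\to\mathcal U$ with $u_*(x,p)\in\arg\max_{u\in\mathcal U}h(x,u,p)$ for all $(x,p)$. A maximal policy over $\pi\in\Pi_{\mathsf a}$ is a policy $\pi'$ with $\pi'(x)\in\arg\max_{u\in\mathcal U}h(x,u,\nabla v_\pi(x))$ for all $x$ (it is again admissible, with $v_\pi\le v_{\pi'}$). DPI (differential policy iteration): given an admissible policy $\pi_0$, for $i=1,2,\dots$: (evaluation) $v_i:\mathcal X\to\mathbb R$ is a $\mathrm C^1$ function with $\alpha v_i(x)=h(x,\pi_{i-1}(x),\nabla v_i(x))$ for all $x$; (improvement) $\pi_i$ is a policy with $\pi_i(x)\in\arg\max_{u\in\mathcal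 U}h(x,u,\nabla v_i(x))$ for all $x$. IPI (integral policy iteration): given an admissible policy $\pi_0$ and a fixed $\eta>0$, for $i=1,2,\dots$: (evaluation) $v_i:\mathcal X\to\mathbb R$ is a $\mathrm C^1$ function with $v_i(x)=\mathbb G_{\pi_{i-1}}^x[\int_0^\eta\gamma^tR_t\,dt+\gamma^\eta v_i(X_\eta)]$ for all $x$; (improvement) $\pi_i$ is a policy with $\pi_i(x)\in\arg\max_{u\in\mathcal U}[r(x,u)+\nabla v_i(x)f_{\mathsf c}(x,u)]$ for all $x$, where $f(x,u)=f_{\mathsf d}(x)+f_{\mathsf c}(x,u)$ with $f_{\mathsf d},f_{\mathsf c}$ continuous (the same argmax set as for $h(x,\cdot,\nabla v_i(x))$). Under the boundary condition in the claim, $\pi_{i-1}\in\Pi_{\mathsf a}$ and $v_i=v_{\pi_{i-1}}$ for all $i\in\mathbb N$. Policy iteration operator: $\mathcal T:\mathcal V_{\mathsf a}\to\mathcal V_{\mathsf a}$ is a map with $\mathcal Tv_{\pi_{i-1}}=v_{\pi_i}$ for every $i\in\mathbb N$, and $\mathcal Tv_\pi=v_{\pi'}$ for any other $v_\pi\in\mathcal V_{\mathsf a}$, where $\pi'$ is a (chosen) maximal policy over $\pi$. Thus $v_i=\mathcal T^{i-1}v_1$. *)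

theory Defs
  imports "HOL-Analysis.Analysis"
begin

text \<open>
  States are column vectors in \<open>real ^ 'l\<close> and actions lie in a subset \<open>U\<close> of \<open>real ^ 'm\<close>.
  A row vector \<open>p\<close> is also represented by an element of \<open>real ^ 'l\<close>, so the matrix product
  \<open>p f\<close> of a row and a column becomes the inner product \<open>p \<bullet> f\<close>.
  Functions of \<open>(x, u)\<close> are curried and total; only their values for \<open>u \<in> U\<close> are constrained.
\<close>

definition continuous_in_both ::
  "'u::topological_space set \<Rightarrow> ('x::topological_space \<Rightarrow> 'u \<Rightarrow> 'y::topological_space) \<Rightarrow> bool"
  where "continuous_in_both U g \<longleftrightarrow> continuous_on (UNIV \<times> U) (\<lambda>(x, u). g x u)"

definition grad :: "(real ^ 'l \<Rightarrow> real) \<Rightarrow> real ^ 'l \<Rightarrow> real ^ 'l"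
  where "grad v x = (THE D. GDERIV v x :> D)"

definition C1 :: "(real ^ 'l \<Rightarrow> real) \<Rightarrow> bool"
  where "C1 v \<longleftrightarrow> (\<forall>x. v differentiable (at x)) \<and> continuous_on UNIV (grad v)"


section \<open>Environment, policies and value functions\<close>

definition trajectory ::
  "(real ^ 'l \<Rightarrow> real ^ 'm \<Rightarrow> real ^ 'l) \<Rightarrow> real ^ 'l \<Rightarrow> (real \<Rightarrow> real ^ 'm) \<Rightarrow> (real \<Rightarrow> real ^ 'l) \<Rightarrow> bool"
  where "trajectory f x W X \<longleftrightarrow>
    X 0 = x \<and> (\<forall>t\<ge>0. (X has_vector_derivative f (X t) (W t)) (at t within {0..}))"

definition closed_loop ::
  "(real ^ 'l \<Rightarrow> real ^ 'm \<Rightarrow> real ^ 'l) \<Rightarrow> (real ^ 'l \<Rightarrow> real ^ 'm) \<Rightarrow> real ^ 'l \<Rightarrow> (real \<Rightarrow> real ^ 'l) \<Rightarrow> bool"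
  where "closed_loop f \<pi> x X \<longleftrightarrow> trajectory f x (\<lambda>t. \<pi> (X t)) X"

text \<open>Existence of a function with property \<open>P\<close>, unique on the time space \<open>[0,\<infinity>)\<close>.\<close>

definition uniquely_defined :: "((real \<Rightarrow> 'x) \<Rightarrow> bool) \<Rightarrow> bool"
  where "uniquely_defined P \<longleftrightarrow> (\<exists>X. P X \<and> (\<forall>Y. P Y \<longrightarrow> (\<forall>t\<ge>0. Y t = X t)))"

text \<open>The state \<open>X\<^sub>t\<close> under \<open>\<pi>\<close> started at \<open>x\<close>; its values at negative times are irrelevant.\<close>

definition state ::
  "(real ^ 'l \<Rightarrow> real ^ 'm \<Rightarrow> real ^ 'l) \<Rightarrow> (real ^ 'l \<Rightarrow> real ^ 'm) \<Rightarrow> real ^ 'l \<Rightarrow> real \<Rightarrow> real ^ 'l"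
  where "state f \<pi> x = (SOME X. closed_loop f \<pi> x X)"

definition policy :: "(real ^ 'm) set \<Rightarrow> (real ^ 'l \<Rightarrow> real ^ 'm) \<Rightarrow> bool"
  where "policy U \<pi> \<longleftrightarrow> continuous_on UNIV \<pi> \<and> range \<pi> \<subseteq> U"

definition discounted_reward ::
  "(real ^ 'l \<Rightarrow> real ^ 'm \<Rightarrow> real ^ 'l) \<Rightarrow> (real ^ 'l \<Rightarrow> real ^ 'm \<Rightarrow> real) \<Rightarrow> real \<Rightarrow>
   (real ^ 'l \<Rightarrow> real ^ 'm) \<Rightarrow> real ^ 'l \<Rightarrow> real \<Rightarrow> real"
  where "discounted_reward f r \<gamma> \<pi> x T =
    integral {0..T} (\<lambda>t. \<gamma> powr t * r (state f \<pi> x t) (\<pi> (state f \<pi> x t)))"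

text \<open>
  The integral over \<open>[0,\<infinity>)\<close> is the limit of the integrals over \<open>[0,T]\<close>. Under the standing
  assumptions below the rewards are bounded above (by 0 if \<open>\<gamma> = 1\<close>), so this limit always
  exists in \<open>[-\<infinity>,\<infinity>)\<close> and coincides with the extended-real-valued Lebesgue integral.
\<close>

definition value_fn ::
  "(real ^ 'l \<Rightarrow> real ^ 'm \<Rightarrow> real ^ 'l) \<Rightarrow> (real ^ 'l \<Rightarrow> real ^ 'm \<Rightarrow> real) \<Rightarrow> real \<Rightarrow>
   (real ^ 'l \<Rightarrow> real ^ 'm) \<Rightarrow> real ^ 'l \<Rightarrow> ereal"
  where "value_fn f r \<gamma> \<pi> x = Lim at_top (\<lambda>T. ereal (discounted_reward f r \<gamma> \<pi> x T))"

definition admissible ::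
  "(real ^ 'm) set \<Rightarrow> (real ^ 'l \<Rightarrow> real ^ 'm \<Rightarrow> real ^ 'l) \<Rightarrow> (real ^ 'l \<Rightarrow> real ^ 'm \<Rightarrow> real) \<Rightarrow> real \<Rightarrow>
   (real ^ 'l \<Rightarrow> real ^ 'm) \<Rightarrow> bool"
  where "admissible U f r \<gamma> \<pi> \<longleftrightarrow> policy U \<pi> \<and> (\<forall>x. \<bar>value_fn f r \<gamma> \<pi> x\<bar> \<noteq> \<infinity>)"

text \<open>The value function as a real-valued function; meaningful only for admissible policies.\<close>

definition real_value_fn ::
  "(real ^ 'l \<Rightarrow> real ^ 'm \<Rightarrow> real ^ 'l) \<Rightarrow> (real ^ 'l \<Rightarrow> real ^ 'm \<Rightarrow> real) \<Rightarrow> real \<Rightarrow>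
   (real ^ 'l \<Rightarrow> real ^ 'm) \<Rightarrow> real ^ 'l \<Rightarrow> real"
  where "real_value_fn f r \<gamma> \<pi> x = real_of_ereal (value_fn f r \<gamma> \<pi> x)"

definition admissible_VFs ::
  "(real ^ 'm) set \<Rightarrow> (real ^ 'l \<Rightarrow> real ^ 'm \<Rightarrow> real ^ 'l) \<Rightarrow> (real ^ 'l \<Rightarrow> real ^ 'm \<Rightarrow> real) \<Rightarrow> real \<Rightarrow>
   (real ^ 'l \<Rightarrow> real) set"
  where "admissible_VFs U f r \<gamma> = real_value_fn f r \<gamma> ` {\<pi>. admissible U f r \<gamma> \<pi>}"

definition hamiltonian ::
  "(real ^ 'l \<Rightarrow> real ^ 'm \<Rightarrow> real ^ 'l) \<Rightarrow> (real ^ 'l \<Rightarrow> real ^ 'm \<Rightarrow> real) \<Rightarrow>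
   real ^ 'l \<Rightarrow> real ^ 'm \<Rightarrow> real ^ 'l \<Rightarrow> real"
  where "hamiltonian f r x u p = r x u + p \<bullet> f x u"

definition argmax_on :: "'u set \<Rightarrow> ('u \<Rightarrow> real) \<Rightarrow> 'u set"
  where "argmax_on U g = {u. is_arg_max g (\<lambda>w. w \<in> U) u}"

text \<open>\<open>\<pi>'\<close> is a maximal policy with respect to \<open>v\<close>, i.e. over \<open>\<pi>\<close> when \<open>v\<close> is the value function of \<open>\<pi>\<close>.\<close>

definition maximal_policy ::
  "(real ^ 'm) set \<Rightarrow> (real ^ 'l \<Rightarrow> real ^ 'm \<Rightarrow> real ^ 'l) \<Rightarrow> (real ^ 'l \<Rightarrow> real ^ 'm \<Rightarrow> real) \<Rightarrow>
   (real ^ 'l \<Rightarrow> real) \<Rightarrow> (real ^ 'l \<Rightarrow> real ^ 'm) \<Rightarrow> bool"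
  where "maximal_policy U f r v \<pi>' \<longleftrightarrow>
    policy U \<pi>' \<and> (\<forall>x. \<pi>' x \<in> argmax_on U (\<lambda>u. hamiltonian f r x u (grad v x)))"

locale ct_rl_problem =
  fixes U :: "(real ^ 'm) set"
    and f :: "real ^ 'l \<Rightarrow> real ^ 'm \<Rightarrow> real ^ 'l"
    and r :: "real ^ 'l \<Rightarrow> real ^ 'm \<Rightarrow> real"
    and \<gamma> :: real
  assumes action_space: "\<exists>S. open S \<and> (U = S \<or> U = S \<union> frontier S)"
    and f_continuous: "continuous_in_both U f"
    and r_continuous: "continuous_in_both U r"
    and discount: "0 < \<gamma>" "\<gamma> \<le> 1"
    and open_loop_trajectories:
      "\<And>x W. continuous_on {0..} W \<Longrightarrow> W ` {0..} \<subseteq> U \<Longrightarrow> uniquely_defined (trajectory f x W)"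
    and closed_loop_trajectories:
      "\<And>x \<pi>. policy U \<pi> \<Longrightarrow> uniquely_defined (closed_loop f \<pi> x)"
    and reward_max:
      "\<exists>x\<^sub>0. \<exists>u\<^sub>0\<in>U. (\<forall>x. \<forall>u\<in>U. r x u \<le> r x\<^sub>0 u\<^sub>0) \<and> (\<gamma> = 1 \<longrightarrow> r x\<^sub>0 u\<^sub>0 = 0)"
    and admissible_exists: "\<exists>\<pi>. admissible U f r \<gamma> \<pi>"
    and admissible_VF_C1: "\<And>v. v \<in> admissible_VFs U f r \<gamma> \<Longrightarrow> C1 v"
    and continuous_maximizer:
      "\<exists>ustar :: real ^ 'l \<Rightarrow> real ^ 'l \<Rightarrow> real ^ 'm. continuous_on UNIV (\<lambda>(x, p). ustar x p) \<and>
         (\<forall>x p. ustar x p \<in> argmax_on U (\<lambda>u. hamiltonian f r x u p))"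


section \<open>Policy iteration\<close>

text \<open>In both schemes \<open>v\<close> is used from index 1 on; \<open>v 0\<close> is unconstrained. Below \<open>- ln \<gamma>\<close> is \<open>\<alpha>\<close>.\<close>

definition DPI ::
  "(real ^ 'm) set \<Rightarrow> (real ^ 'l \<Rightarrow> real ^ 'm \<Rightarrow> real ^ 'l) \<Rightarrow> (real ^ 'l \<Rightarrow> real ^ 'm \<Rightarrow> real) \<Rightarrow> real \<Rightarrow>
   (nat \<Rightarrow> real ^ 'l \<Rightarrow> real ^ 'm) \<Rightarrow> (nat \<Rightarrow> real ^ 'l \<Rightarrow> real) \<Rightarrow> bool"
  where "DPI U f r \<gamma> \<pi> v \<longleftrightarrow>
    admissible U f r \<gamma> (\<pi> 0) \<and>
    (\<forall>i\<ge>1.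
      C1 (v i) \<and>
      (\<forall>x. - ln \<gamma> * v i x = hamiltonian f r x (\<pi> (i - 1) x) (grad (v i) x)) \<and>
      policy U (\<pi> i) \<and>
      (\<forall>x. \<pi> i x \<in> argmax_on U (\<lambda>u. hamiltonian f r x u (grad (v i) x))))"

definition IPI ::
  "(real ^ 'm) set \<Rightarrow> (real ^ 'l \<Rightarrow> real ^ 'm \<Rightarrow> real ^ 'l) \<Rightarrow> (real ^ 'l \<Rightarrow> real ^ 'm \<Rightarrow> real) \<Rightarrow> real \<Rightarrow>
   real \<Rightarrow> (real ^ 'l \<Rightarrow> real ^ 'l) \<Rightarrow> (real ^ 'l \<Rightarrow> real ^ 'm \<Rightarrow> real ^ 'l) \<Rightarrow>
   (nat \<Rightarrow> real ^ 'l \<Rightarrow> real ^ 'm) \<Rightarrow> (nat \<Rightarrow> real ^ 'l \<Rightarrow> real) \<Rightarrow> bool"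
  where "IPI U f r \<gamma> \<eta> fd fc \<pi> v \<longleftrightarrow>
    0 < \<eta> \<and>
    continuous_on UNIV fd \<and> continuous_in_both U fc \<and> (\<forall>x. \<forall>u\<in>U. f x u = fd x + fc x u) \<and>
    admissible U f r \<gamma> (\<pi> 0) \<and>
    (\<forall>i\<ge>1.
      C1 (v i) \<and>
      (\<forall>x. v i x = discounted_reward f r \<gamma> (\<pi> (i - 1)) x \<eta>
                   + \<gamma> powr \<eta> * v i (state f (\<pi> (i - 1)) x \<eta>)) \<and>
      policy U (\<pi> i) \<and>
      (\<forall>x. \<pi> i x \<in> argmax_on U (\<lambda>u. r x u + grad (v i) x \<bullet> fc x u)))"

definition boundary_condition ::
  "(real ^ 'm) set \<Rightarrow> (real ^ 'l \<Rightarrow> real ^ 'm \<Rightarrow> real ^ 'l) \<Rightarrow> (real ^ 'l \<Rightarrow> real ^ 'm \<Rightarrow> real) \<Rightarrow> real \<Rightarrow>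
   (nat \<Rightarrow> real ^ 'l \<Rightarrow> real ^ 'm) \<Rightarrow> (nat \<Rightarrow> real ^ 'l \<Rightarrow> real) \<Rightarrow> bool"
  where "boundary_condition U f r \<gamma> \<pi> v \<longleftrightarrow>
    (\<forall>i\<ge>1. admissible U f r \<gamma> (\<pi> (i - 1)) \<longrightarrow>
      (\<forall>x. ((\<lambda>t. \<gamma> powr t * v i (state f (\<pi> (i - 1)) x t)) \<longlongrightarrow> 0) at_top))"

definition PI_operator ::
  "(real ^ 'm) set \<Rightarrow> (real ^ 'l \<Rightarrow> real ^ 'm \<Rightarrow> real ^ 'l) \<Rightarrow> (real ^ 'l \<Rightarrow> real ^ 'm \<Rightarrow> real) \<Rightarrow> real \<Rightarrow>
   (nat \<Rightarrow> real ^ 'l \<Rightarrow> real ^ 'm) \<Rightarrow> ((real ^ 'l \<Rightarrow> real) \<Rightarrow> real ^ 'l \<Rightarrow> real) \<Rightarrow> bool"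
  where "PI_operator U f r \<gamma> \<pi> \<T> \<longleftrightarrow>
    \<T> \<in> admissible_VFs U f r \<gamma> \<rightarrow> admissible_VFs U f r \<gamma> \<and>
    (\<forall>i\<ge>1. \<T> (real_value_fn f r \<gamma> (\<pi> (i - 1))) = real_value_fn f r \<gamma> (\<pi> i)) \<and>
    (\<forall>v \<in> admissible_VFs U f r \<gamma>.
      (\<forall>i\<ge>1. v \<noteq> real_value_fn f r \<gamma> (\<pi> (i - 1))) \<longrightarrow>
      (\<exists>\<pi>'. maximal_policy U f r v \<pi>' \<and> \<T> v = real_value_fn f r \<gamma> \<pi>'))"

definition contraction_on :: "'a set \<Rightarrow> ('a \<Rightarrow> 'a \<Rightarrow> real) \<Rightarrow> ('a \<Rightarrow> 'a) \<Rightarrow> bool"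
  where "contraction_on M d F \<longleftrightarrow>
    (\<exists>k. 0 \<le> k \<and> k < 1 \<and> (\<forall>x\<in>M. \<forall>y\<in>M. d (F x) (F y) \<le> k * d x y))"

end

theory Submission
  imports Defs
begin

text \<open>
  Policy improvement makes \<open>\<T>\<close> increasing: along the closed loop of a maximal policy \<open>\<pi>'\<close> over \<open>\<pi>\<close>,
  the discounted reward collected so far plus \<open>\<gamma>\<^sup>t v\<^sub>\<pi>(X\<^sub>t)\<close> is nondecreasing, and \<open>v\<^sub>\<pi>\<close> is bounded
  above by a constant \<open>B\<close> with \<open>\<gamma>\<^sup>t B \<longlongrightarrow> 0\<close>, so \<open>v\<^sub>\<pi> \<le> v\<^sub>\<pi>\<^sub>'\<close>. A periodic point \<open>w\<close>
  of an increasing map satisfies \<open>w \<le> \<T> w \<le> \<dots> \<le> w\<close> and is therefore a fixed point, hence equal to \<open>v\<^sup>*\<close>.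
  By Bessaga's converse of the Banach fixed-point theorem, a self-map whose only periodic point is a
  fixed point is a contraction under a suitable metric.
\<close>

section \<open>A converse to the contraction principle\<close>

text \<open>Group points whose forward orbits meet and pick one representative \<open>c x\<close>
  per group. If T^m x = T^n (c x), the height of \<open>x\<close> is n - m. Aperiodicity makes the
  iterates of each point distinct, so this difference does not depend on the chosen m and n.\<close>

lemma exists_height:
  fixes T :: "'a \<Rightarrow> 'a"
  assumes "T \<in> N \<rightarrow> N" and aperiodic: "\<And>x n. x \<in> N \<Longrightarrow> 0 < n \<Longrightarrow> (T ^^ n) x \<noteq> x"
  shows "\<exists>h::'a \<Rightarrow> int. \<forall>x\<in>N. h (T x) = h x + 1"
proof -
  define E where "E x y \<longleftrightarrow> (\<exists>m n. (T ^^ m) x = (T ^^ n) y)" for x y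
  define c where "c x = (SOME y. y \<in> N \<and> E x y)" for x
  define H where "H x k \<longleftrightarrow> (\<exists>m n. (T ^^ m) x = (T ^^ n) (c x) \<and> k = int n - int m)" for x k
  have iter: "(T ^^ n) x \<in> N" if "x \<in> N" for x n
    using that assms(1) by (induction n) auto
  have "E (T x) y \<longleftrightarrow> E x y" for x y
  proof
    assume "E (T x) y"
    then obtain m n where "(T ^^ Suc m) x = (T ^^ n) y"
      unfolding E_def by (auto simp: funpow_swap1)
    then show "E x y" unfolding E_def by blast
  next
    assume "E x y"
    then obtain m n where "(T ^^ m) x = (T ^^ n) y"
      unfolding E_def by blast
    then have "(T ^^ m) (T x) = (T ^^ Suc n) y"
      by (simp flip: funpow_swap1)
    then show "E (T x) y" unfolding E_def by blast
  qed
  \<comment> \<open>The predicates \<open>E (T x)\<close> and \<open>E x\<close> agree, so the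
    choice operator returns the same representative.\<close>
  then have c_step: "c (T x) = c x" for x
    unfolding c_def by simp
  have c: "c x \<in> N \<and> E x (c x)" if "x \<in> N" for x
    unfolding c_def by (rule someI_ex) (use that E_def in blast)
  have H_ex: "\<exists>k. H x k" if "x \<in> N" for x
    using c[OF that] unfolding H_def E_def by blast
  have H_step: "H (T x) (k + 1)" if k: "H x k" for x k
  proof -
    obtain m n where "(T ^^ m) x = (T ^^ n) (c x)" "k = int n - int m"
      using k unfolding H_def by blast
    then have "(T ^^ m) (T x) = (T ^^ Suc n) (c (T x))" "k + 1 = int (Suc n) - int m"
      by (simp_all add: c_step flip: funpow_swap1)
    then show ?thesis unfolding H_def by blast
  qed
  have shift: "(T ^^ (a + k)) y \<noteq> (T ^^ a) y" if "y \<in> N" "0 < k" for y a k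
    using aperiodic[OF iter[OF that(1), of a] that(2)] by (simp add: add.commute[of a] funpow_add)
  have inj: "a = b" if "y \<in> N" "(T ^^ a) y = (T ^^ b) y" for y a b
    using shift[OF that(1), of "b - a" a] shift[OF that(1), of "a - b" b] that(2)
    by (cases a b rule: linorder_cases) auto
  have H_unique: "k = l" if "x \<in> N" and k: "H x k" and l: "H x l" for x k l
  proof -
    obtain m n where mn: "(T ^^ m) x = (T ^^ n) (c x)" "k = int n - int m"
      using k unfolding H_def by blast
    obtain m' n' where mn': "(T ^^ m') x = (T ^^ n') (c x)" "l = int n' - int m'"
      using l unfolding H_def by blast
    \<comment> \<open>Both meeting relations are pushed forward to the common point T^(m+m') x,
      where the exponents of \<open>c x\<close> can be compared.\<close>
    have "(T ^^ (m' + n)) (c x) = (T ^^ (m' + m)) x"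
      using mn by (simp add: funpow_add)
    also have "\<dots> = (T ^^ (m + n')) (c x)"
      using mn' by (simp add: funpow_add add.commute[of m'])
    finally have "m' + n = m + n'"
      using inj c[OF \<open>x \<in> N\<close>] by blast
    then show ?thesis using mn mn' by simp
  qed
  have H_SOME: "H x (SOME k. H x k)" if "x \<in> N" for x
    using H_ex[OF that] by (rule someI_ex)
  show ?thesis
  proof (intro exI[of _ "\<lambda>x. SOME k. H x k"] ballI)
    fix x assume "x \<in> N"
    then show "(SOME k. H (T x) k) = (SOME k. H x k) + 1"
      using H_unique H_SOME H_step assms(1) by blast
  qed
qed

text \<open>Points that reach \<open>p\<close> get 2 to the number of steps they need, and
  \<open>p\<close> itself gets 0. The points that never reach \<open>p\<close> form a set
  \<open>N\<close> that \<open>T\<close> preserves and that has no periodic points, so it carries a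
  height growing by 1 per step; there the potential is 1/2 to the height.\<close>

lemma exists_halving_potential:
  fixes T :: "'a \<Rightarrow> 'a"
  assumes T: "T \<in> M \<rightarrow> M" and p: "T p = p"
    and periodic: "\<And>x n. x \<in> M \<Longrightarrow> 0 < n \<Longrightarrow> (T ^^ n) x = x \<Longrightarrow> x = p"
  obtains \<phi> :: "'a \<Rightarrow> real" where "\<And>x. 0 \<le> \<phi> x" "\<And>x. \<phi> x = 0 \<longleftrightarrow> x = p"
    "\<And>x. x \<in> M \<Longrightarrow> \<phi> (T x) \<le> \<phi> x / 2"
proof -
  define N where "N = {x \<in> M. \<forall>n. (T ^^ n) x \<noteq> p}"
  have iter: "(T ^^ n) x \<in> M" if "x \<in> M" for x n
    using that T by (induction n) auto
  have N_step: "T x \<in> N \<longleftrightarrow> x \<in> N" if "x \<in> M" for x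
  proof -
    have "(T ^^ Suc n) x = p" if "(T ^^ n) (T x) = p" for n
      using that by (simp add: funpow_swap1)
    moreover have "(T ^^ n) (T x) = p" if "(T ^^ n) x = p" for n
      using that p by (simp flip: funpow_swap1)
    ultimately have "(\<exists>n. (T ^^ n) (T x) = p) \<longleftrightarrow> (\<exists>n. (T ^^ n) x = p)"
      by blast
    then show ?thesis using that T unfolding N_def by auto
  qed
  \<comment> \<open>A periodic point would be \<open>p\<close>, and the case n = 0 in the definition
    of \<open>N\<close> excludes \<open>p\<close>.\<close>
  have "(T ^^ n) x \<noteq> x" if "x \<in> N" "0 < n" for x n
    using that periodic unfolding N_def by (metis (mono_tags, lifting) funpow_0 mem_Collect_eq)
  then obtain h :: "'a \<Rightarrow> int" where h: "\<And>x. x \<in> N \<Longrightarrow> h (T x) = h x + 1"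
    using exists_height[of T N] N_step unfolding N_def by auto
  define \<tau> where "\<tau> x = (LEAST n. (T ^^ n) x = p)" for x
  define \<phi> where "\<phi> x = (if x = p then 0 else if x \<in> N then (1/2) powi h x else 2 ^ \<tau> x :: real)" for x
  have "\<phi> (T x) \<le> \<phi> x / 2" if x: "x \<in> M" for x
  proof (cases "x \<in> N")
    case True
    have "y \<noteq> p" if "y \<in> N" for y
      using that unfolding N_def by (metis (mono_tags, lifting) funpow_0 mem_Collect_eq)
    then have "x \<noteq> p" "T x \<in> N" "T x \<noteq> p"
      using N_step[OF x] True by blast+
    then show ?thesis
      using True h by (simp add: \<phi>_def power_int_add)
  next
    case False
    then obtain n where n: "(T ^^ n) x = p" using x N_def by auto
    show ?thesis
    proof (cases "T x = p")
      case True
      then show ?thesis using p by (simp add: \<phi>_def)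
    next
      case neq: False
      then have x_neq: "x \<noteq> p" using p by blast
      have "\<tau> x = Suc (\<tau> (T x))"
        unfolding \<tau>_def using Least_Suc[of "\<lambda>n. (T ^^ n) x = p" n] n x_neq
        by (simp add: funpow_swap1)
      then show ?thesis
        using neq p False N_step[OF x] by (auto simp: \<phi>_def)
    qed
  qed
  moreover have "0 \<le> \<phi> x" "\<phi> x = 0 \<longleftrightarrow> x = p" for x
    by (auto simp: \<phi>_def)
  ultimately show thesis by (intro that)
qed

text \<open>
  Summing potentials makes every point other than \<open>p\<close> isolated, so the triangle inequality is
  immediate and contraction of the metric reduces to contraction of the potential.
\<close>

lemma contracting_metric_if_no_periodic_points:
  fixes T :: "'a \<Rightarrow> 'a"
  assumes T: "T \<in> M \<rightarrow> M" and p: "T p = p"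
    and periodic: "\<And>x n. x \<in> M \<Longrightarrow> 0 < n \<Longrightarrow> (T ^^ n) x = x \<Longrightarrow> x = p"
  shows "\<exists>d. Metric_space M d \<and> contraction_on M d T"
proof -
  obtain \<phi> :: "'a \<Rightarrow> real" where \<phi>: "\<And>x. 0 \<le> \<phi> x" "\<And>x. \<phi> x = 0 \<longleftrightarrow> x = p"
      "\<And>x. x \<in> M \<Longrightarrow> \<phi> (T x) \<le> \<phi> x / 2"
    by (rule exists_halving_potential[OF T p]) (erule (2) periodic, rule that)
  define d where "d x y = (if x = y then 0 else \<phi> x + \<phi> y)" for x y
  have "Metric_space M d"
  proof
    show "d x y = 0 \<longleftrightarrow> x = y" for x y
      using \<phi>(1)[of x] \<phi>(1)[of y] \<phi>(2)[of x] \<phi>(2)[of y] by (auto simp: d_def)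
    show "d x z \<le> d x y + d y z" for x y z
      using \<phi>(1)[of x] \<phi>(1)[of y] \<phi>(1)[of z] by (auto simp: d_def)
  qed (use \<phi>(1) in \<open>auto simp: d_def\<close>)
  moreover have "d (T x) (T y) \<le> 1/2 * d x y" if "x \<in> M" "y \<in> M" for x y
    using \<phi>(1)[of x] \<phi>(1)[of y] \<phi>(3)[OF that(1)] \<phi>(3)[OF that(2)] by (auto simp: d_def)
  then have "contraction_on M d T"
    unfolding contraction_on_def by (intro exI[of _ "1/2"]) auto
  ultimately show ?thesis by blast
qed

section \<open>Continuity and convergent iterates of contractions\<close>

lemma (in Metric_space) contraction_continuous_map:
  assumes T: "T \<in> M \<rightarrow> M" and "contraction_on M d T"
  shows "continuous_map mtopology mtopology T"
proof -
  obtain k where k: "0 \<le> k" "k < 1" "\<And>x y. x \<in> M \<Longrightarrow> y \<in> M \<Longrightarrow> d (T x) (T y) \<le> k * d x y"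
    using assms(2) unfolding contraction_on_def by blast
  have "d (T x) (T y) \<le> d x y" if "x \<in> M" "y \<in> M" for x y
    using k(3)[OF that] k(2) mult_right_mono[of k 1 "d x y"] by simp
  then show ?thesis
    unfolding metric_continuous_map[OF Metric_space_axioms] using T
    by (intro conjI ballI allI impI) (force, meson le_less_trans)
qed

lemma (in Metric_space) contraction_iterates_limitin:
  assumes T: "T \<in> M \<rightarrow> M" and "contraction_on M d T" and p: "p \<in> M" "T p = p" and "x \<in> M"
  shows "limitin mtopology (\<lambda>n. (T ^^ n) x) p sequentially"
proof -
  obtain k where k: "0 \<le> k" "k < 1" "\<And>x y. x \<in> M \<Longrightarrow> y \<in> M \<Longrightarrow> d (T x) (T y) \<le> k * d x y"
    using assms(2) unfolding contraction_on_def by blast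
  have iter: "(T ^^ n) x \<in> M" for n
    using \<open>x \<in> M\<close> T by (induction n) auto
  have bound: "d ((T ^^ n) x) p \<le> k ^ n * d x p" for n
  proof (induction n)
    case (Suc n)
    have "d ((T ^^ Suc n) x) p \<le> k * d ((T ^^ n) x) p"
      using k(3)[OF iter p(1)] p(2) by simp
    then show ?case
      using mult_left_mono[OF Suc k(1)] by (simp add: mult.assoc)
  qed simp
  have "(\<lambda>n. k ^ n * d x p) \<longlonglongrightarrow> 0"
    using LIMSEQ_realpow_zero[OF k(1,2)] by (simp add: tendsto_mult_left_zero)
  then have "(\<lambda>n. d ((T ^^ n) x) p) \<longlonglongrightarrow> 0"
    by (rule Lim_null_comparison[rotated]) (use bound in simp)
  then show ?thesis
    using iter p(1) by (simp add: limitin_metric_dist_null)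
qed

section \<open>Gradients, discount factors and maximizers\<close>

text \<open>\<open>grad\<close> is a definite description, so existence and uniqueness are both
  required. A linear functional is the inner product with its adjoint at 1, and inner products with
  all vectors determine a vector.\<close>

lemma GDERIV_grad:
  assumes "v differentiable (at x)"
  shows "GDERIV v x :> grad v x"
proof -
  obtain v' where v': "(v has_derivative v') (at x)"
    using assms unfolding differentiable_def by blast
  then have "linear v'"
    using has_derivative_linear by blast
  have "v' = (\<lambda>h. h \<bullet> adjoint v' 1)"
    using adjoint_works[OF \<open>linear v'\<close>, of _ 1] by auto
  with v' have gderiv: "GDERIV v x :> adjoint v' 1"
    unfolding gderiv_def by (rule has_derivative_subst)
  have "D = adjoint v' 1" if "GDERIV v x :> D" for D
  proof -
    have "(\<lambda>h. h \<bullet> D) = (\<lambda>h. h \<bullet> adjoint v' 1)"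
      using that gderiv unfolding gderiv_def by (rule has_derivative_unique)
    then show ?thesis
      by (simp only: fun_eq_iff vector_eq_ldot)
  qed
  with gderiv show ?thesis
    unfolding grad_def by (rule theI)
qed

lemma C1_GDERIV: "C1 v \<Longrightarrow> GDERIV v x :> grad v x"
  unfolding C1_def by (blast intro: GDERIV_grad)

lemma has_real_derivative_powr_exponent:
  fixes a :: real
  assumes "0 < a"
  shows "((\<lambda>t. a powr t) has_real_derivative a powr t * ln a) (at t within S)"
  unfolding powr_def using assms by (auto intro!: derivative_eq_intros)

text \<open>The two objectives differ by \<open>p \<bullet> fd x\<close>, which is constant in
  \<open>u\<close>. Hence improvement in IPI also produces maximal policies.\<close>

lemma hamiltonian_argmax_iff:
  assumes "\<And>u. u \<in> U \<Longrightarrow> f x u = fd x + fc x u"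
  shows "argmax_on U (\<lambda>u. hamiltonian f r x u p) = argmax_on U (\<lambda>u. r x u + p \<bullet> fc x u)"
  using assms unfolding argmax_on_def is_arg_max_def hamiltonian_def
  by (fastforce simp: inner_add_right not_less)

section \<open>Closed-loop flow and discounted rewards\<close>

context ct_rl_problem
begin

lemma closed_loop_state:
  assumes "policy U \<pi>"
  shows "closed_loop f \<pi> x (state f \<pi> x)"
  unfolding state_def using closed_loop_trajectories[OF assms, of x]
  by (intro someI_ex[of "closed_loop f \<pi> x"]) (auto simp: uniquely_defined_def)

lemma state_unique:
  assumes "policy U \<pi>" "closed_loop f \<pi> x X" "0 \<le> t"
  shows "X t = state f \<pi> x t"
  using closed_loop_trajectories[OF assms(1), of x] closed_loop_state[OF assms(1), of x] assms(2,3)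
  unfolding uniquely_defined_def by metis

lemma state_0: "policy U \<pi> \<Longrightarrow> state f \<pi> x 0 = x"
  using closed_loop_state unfolding closed_loop_def trajectory_def by blast

lemma state_has_vector_derivative:
  assumes "policy U \<pi>" "0 \<le> t"
  shows "(state f \<pi> x has_vector_derivative f (state f \<pi> x t) (\<pi> (state f \<pi> x t))) (at t within {0..})"
  using closed_loop_state[OF assms(1)] assms(2) unfolding closed_loop_def trajectory_def by blast

text \<open>The closed loop is autonomous: a trajectory shifted by \<open>s\<close> solves the same
  equation from its state at time \<open>s\<close>, and uniqueness identifies it with the restarted
  one.\<close>

lemma state_add:
  assumes \<pi>: "policy U \<pi>" and "0 \<le> s" "0 \<le> t"
  shows "state f \<pi> (state f \<pi> x s) t = state f \<pi> x (s + t)"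
proof -
  let ?X = "\<lambda>t. state f \<pi> x (s + t)"
  have "(?X has_vector_derivative f (?X t) (\<pi> (?X t))) (at t within {0..})" if "0 \<le> t" for t
  proof -
    have "(state f \<pi> x has_vector_derivative f (?X t) (\<pi> (?X t))) (at (s + t) within (+) s ` {0..})"
      using state_has_vector_derivative[OF \<pi>, of "s + t" x] that \<open>0 \<le> s\<close>
      by (auto intro: has_vector_derivative_within_subset)
    moreover have "((+) s has_vector_derivative 1) (at t within {0..})"
      by (auto intro!: derivative_eq_intros)
    ultimately show ?thesis
      using vector_diff_chain_within[of "(+) s" 1 t "{0..}" "state f \<pi> x"] by (simp add: o_def)
  qed
  then have "closed_loop f \<pi> (state f \<pi> x s) ?X"
    unfolding closed_loop_def trajectory_def by simp
  from state_unique[OF \<pi> this \<open>0 \<le> t\<close>] show ?thesis by simp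
qed

lemma continuous_on_state:
  assumes "policy U \<pi>"
  shows "continuous_on {0..} (state f \<pi> x)"
  using state_has_vector_derivative[OF assms] has_vector_derivative_continuous
  by (force simp: continuous_on_eq_continuous_within)

lemma continuous_on_policy_reward:
  assumes \<pi>: "policy U \<pi>"
  shows "continuous_on {0..} (\<lambda>t. \<gamma> powr t * r (state f \<pi> x t) (\<pi> (state f \<pi> x t)))"
proof -
  have "continuous_on {0..} (\<lambda>t. (state f \<pi> x t, \<pi> (state f \<pi> x t)))"
    using continuous_on_state[OF \<pi>] \<pi> unfolding policy_def
    by (auto intro!: continuous_intros continuous_on_compose2[of UNIV \<pi>])
  then have "continuous_on {0..} (\<lambda>t. r (state f \<pi> x t) (\<pi> (state f \<pi> x t)))"
    using continuous_on_compose2[OF r_continuous[unfolded continuous_in_both_def]] \<pi>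
    unfolding policy_def by fastforce
  then show ?thesis
    using discount by (intro continuous_intros) auto
qed

lemma policy_reward_integrable:
  assumes "policy U \<pi>" "0 \<le> a"
  shows "(\<lambda>t. \<gamma> powr t * r (state f \<pi> x t) (\<pi> (state f \<pi> x t))) integrable_on {a..b}"
  using assms
  by (intro integrable_continuous_real continuous_on_subset[OF continuous_on_policy_reward]) auto

lemma has_integral_discounted_reward:
  assumes "policy U \<pi>"
  shows "((\<lambda>t. \<gamma> powr t * r (state f \<pi> x t) (\<pi> (state f \<pi> x t)))
           has_integral discounted_reward f r \<gamma> \<pi> x T) {0..T}"
  unfolding discounted_reward_def
  using policy_reward_integrable[OF assms order_refl] by (rule integrable_integral)

text \<open>The integral is split at \<open>s\<close>. After shifting time, the flow property turns
  the tail into a run restarted at the state reached, with \<gamma>^s factored out.\<close>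

lemma discounted_reward_add:
  assumes \<pi>: "policy U \<pi>" and "0 \<le> s" "0 \<le> t"
  shows "discounted_reward f r \<gamma> \<pi> x (s + t) =
    discounted_reward f r \<gamma> \<pi> x s + \<gamma> powr s * discounted_reward f r \<gamma> \<pi> (state f \<pi> x s) t"
proof -
  let ?g = "\<lambda>t. \<gamma> powr t * r (state f \<pi> x t) (\<pi> (state f \<pi> x t))"
  let ?y = "state f \<pi> x s"
  have "integral {s..s + t} ?g = integral {0..t} (?g \<circ> (+) s)"
    using integral_shift_Icc_real[of 0 t ?g s] by (simp add: add.commute)
  also have "\<dots> = integral {0..t} (\<lambda>\<tau>. \<gamma> powr s * (\<gamma> powr \<tau> * r (state f \<pi> ?y \<tau>) (\<pi> (state f \<pi> ?y \<tau>))))"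
    using \<open>0 \<le> s\<close> by (intro integral_cong) (simp add: state_add[OF \<pi>] powr_add mult.assoc)
  finally have "integral {s..s + t} ?g = \<gamma> powr s * discounted_reward f r \<gamma> \<pi> ?y t"
    by (simp add: discounted_reward_def)
  then show ?thesis
    using Henstock_Kurzweil_Integration.integral_combine[OF _ _ policy_reward_integrable[OF \<pi> order_refl], of s "s + t" x] assms(2,3)
    by (simp add: discounted_reward_def)
qed

text \<open>For \<open>\<gamma> < 1\<close> the bound is \<open>r\<^sub>m\<^sub>a\<^sub>x / \<alpha>\<close>, and for \<open>\<gamma> = 1\<close> it is 0.\<close>

lemma discounted_reward_bound:
  obtains B where "((\<lambda>t. \<gamma> powr t * B) \<longlongrightarrow> 0) at_top"
    "\<And>\<pi> x t. policy U \<pi> \<Longrightarrow> 0 \<le> t \<Longrightarrow> discounted_reward f r \<gamma> \<pi> x t \<le> B - \<gamma> powr t * B"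
proof -
  obtain rmax where rmax: "\<And>x u. u \<in> U \<Longrightarrow> r x u \<le> rmax" and rmax_1: "\<gamma> = 1 \<Longrightarrow> rmax = 0"
    using reward_max by blast
  \<comment> \<open>For \<gamma> = 1 this reads 0 / 0, which evaluates to the desired bound
    0.\<close>
  define B where "B = rmax / (- ln \<gamma>)"
  have "((\<lambda>t. \<gamma> powr t * B) \<longlongrightarrow> 0) at_top"
  proof (cases "\<gamma> = 1")
    case True
    then show ?thesis by (simp add: B_def)
  next
    case False
    then have "ln \<gamma> < 0" using discount by simp
    then have "filterlim (\<lambda>t. ln \<gamma> * t) at_bot at_top"
      by (intro filterlim_tendsto_neg_mult_at_bot[OF tendsto_const] filterlim_ident)
    then have "((\<lambda>t. exp (ln \<gamma> * t)) \<longlongrightarrow> 0) at_top"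
      by (rule filterlim_compose[OF exp_at_bot])
    then show ?thesis
      using discount by (intro tendsto_mult_left_zero) (simp add: powr_def mult.commute)
  qed
  moreover have "discounted_reward f r \<gamma> \<pi> x t \<le> B - \<gamma> powr t * B"
    if "policy U \<pi>" "0 \<le> t" for \<pi> :: "real ^ 'l \<Rightarrow> real ^ 'm" and x t
  proof -
    \<comment> \<open>Integrating the largest possible reward: -\<gamma>^s B is an antiderivative
      because ln \<gamma> * B = -rmax, also when \<gamma> = 1.\<close>
    have "((\<lambda>s. \<gamma> powr s * rmax) has_integral (- (\<gamma> powr t * B) - - (\<gamma> powr 0 * B))) {0..t}"
    proof (rule fundamental_theorem_of_calculus[OF \<open>0 \<le> t\<close>])
      fix s
      have "ln \<gamma> * B = - rmax"
        using discount rmax_1 by (cases "\<gamma> = 1") (auto simp: B_def)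
      then have "- (\<gamma> powr s * ln \<gamma> * B) = \<gamma> powr s * rmax"
        by (simp add: mult.assoc)
      then show "((\<lambda>s. - (\<gamma> powr s * B)) has_vector_derivative \<gamma> powr s * rmax) (at s within {0..t})"
        unfolding has_real_derivative_iff_has_vector_derivative[symmetric]
        using discount by (auto intro!: derivative_eq_intros has_real_derivative_powr_exponent simp: algebra_simps)
    qed
    from has_integral_le[OF has_integral_discounted_reward[OF that(1), of x] this]
    show ?thesis
      using rmax that(1) discount by (simp add: policy_def range_subsetD mult_left_mono)
  qed
  ultimately show thesis by (rule that)
qed

section \<open>Value functions as limits of discounted rewards\<close>

text \<open>This justifies the \<open>Lim\<close> in \<open>value_fn\<close>, including the value
  -\<infinity>. Discounted reward plus \<gamma>^t B is nonincreasing in t, since the reward still to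
  be collected is bounded by what \<gamma>^t B loses. It therefore converges to its infimum, and the
  added term vanishes in the limit.\<close>

lemma discounted_reward_tendsto:
  assumes \<pi>: "policy U \<pi>"
  shows "((\<lambda>T. ereal (discounted_reward f r \<gamma> \<pi> x T)) \<longlongrightarrow> value_fn f r \<gamma> \<pi> x) at_top"
proof -
  obtain B where B: "((\<lambda>t. \<gamma> powr t * B) \<longlongrightarrow> 0) at_top"
    "\<And>\<pi> x t. policy U \<pi> \<Longrightarrow> 0 \<le> t \<Longrightarrow> discounted_reward f r \<gamma> \<pi> x t \<le> B - \<gamma> powr t * B"
    by (rule discounted_reward_bound) (rule that)
  define G where "G t = discounted_reward f r \<gamma> \<pi> x t + \<gamma> powr t * B" for t
  have G_antimono: "G (s + t) \<le> G s" if "0 \<le> s" "0 \<le> t" for s t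
    using B(2)[OF \<pi> \<open>0 \<le> t\<close>, of "state f \<pi> x s", THEN mult_left_mono, of "\<gamma> powr s"]
    by (simp add: G_def discounted_reward_add[OF \<pi> that] powr_add algebra_simps)
  define L where "L = (INF s\<in>{0..}. ereal (G s))"
  have "((\<lambda>t. ereal (G t)) \<longlongrightarrow> L) at_top"
  proof (rule order_tendstoI)
    fix a assume "a < L"
    then have above: "a < ereal (G t)" if "0 \<le> t" for t
      using that INF_lower[of t "{0..}" "\<lambda>s. ereal (G s)"] unfolding L_def by force
    show "\<forall>\<^sub>F t in at_top. a < ereal (G t)"
      using eventually_ge_at_top[of 0] by eventually_elim (rule above)
  next
    fix a assume "L < a"
    then obtain s where s: "0 \<le> s" "ereal (G s) < a"
      unfolding L_def INF_less_iff by auto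
    have below: "ereal (G t) < a" if "s \<le> t" for t
    proof -
      have "ereal (G t) \<le> ereal (G s)"
        using G_antimono[of s "t - s"] s(1) that by simp
      then show ?thesis using s(2) by (rule le_less_trans)
    qed
    show "\<forall>\<^sub>F t in at_top. ereal (G t) < a"
      using eventually_ge_at_top[of s] by eventually_elim (rule below)
  qed
  moreover have "((\<lambda>t. ereal (- (\<gamma> powr t * B))) \<longlongrightarrow> 0) at_top"
    using tendsto_minus[OF B(1)] by (simp add: zero_ereal_def)
  ultimately have "((\<lambda>t. ereal (G t) + ereal (- (\<gamma> powr t * B))) \<longlongrightarrow> L + 0) at_top"
    by (intro tendsto_add_ereal_general) auto
  then have "((\<lambda>T. ereal (discounted_reward f r \<gamma> \<pi> x T)) \<longlongrightarrow> L) at_top"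
    by (simp add: G_def)
  moreover from tendsto_Lim[OF _ this] have "value_fn f r \<gamma> \<pi> x = L"
    by (simp add: value_fn_def)
  ultimately show ?thesis by simp
qed

lemma real_value_fn_tendsto:
  assumes "admissible U f r \<gamma> \<pi>"
  shows "(discounted_reward f r \<gamma> \<pi> x \<longlongrightarrow> real_value_fn f r \<gamma> \<pi> x) at_top"
proof -
  have "policy U \<pi>" "\<bar>value_fn f r \<gamma> \<pi> x\<bar> \<noteq> \<infinity>"
    using assms unfolding admissible_def by auto
  then show ?thesis
    using discounted_reward_tendsto[of \<pi> x] by (simp add: real_value_fn_def ereal_real flip: lim_ereal)
qed

text \<open>The additivity of discounted rewards, with the second horizon sent to infinity.\<close>

lemma bellman:
  assumes "admissible U f r \<gamma> \<pi>" "0 \<le> t"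
  shows "real_value_fn f r \<gamma> \<pi> x =
    discounted_reward f r \<gamma> \<pi> x t + \<gamma> powr t * real_value_fn f r \<gamma> \<pi> (state f \<pi> x t)"
proof -
  have \<pi>: "policy U \<pi>" using assms(1) by (simp add: admissible_def)
  let ?y = "state f \<pi> x t"
  have "((\<lambda>s. discounted_reward f r \<gamma> \<pi> x t + \<gamma> powr t * discounted_reward f r \<gamma> \<pi> ?y s)
      \<longlongrightarrow> discounted_reward f r \<gamma> \<pi> x t + \<gamma> powr t * real_value_fn f r \<gamma> \<pi> ?y) at_top"
    by (intro tendsto_intros real_value_fn_tendsto assms)
  moreover have "\<forall>\<^sub>F s in at_top. discounted_reward f r \<gamma> \<pi> x t + \<gamma> powr t * discounted_reward f r \<gamma> \<pi> ?y s
      = discounted_reward f r \<gamma> \<pi> x (t + s)"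
    using eventually_ge_at_top[of 0] by eventually_elim (simp add: discounted_reward_add[OF \<pi> assms(2)])
  ultimately have "((\<lambda>s. discounted_reward f r \<gamma> \<pi> x (t + s))
      \<longlongrightarrow> discounted_reward f r \<gamma> \<pi> x t + \<gamma> powr t * real_value_fn f r \<gamma> \<pi> ?y) at_top"
    by (simp cong: tendsto_cong)
  moreover have "((\<lambda>s. discounted_reward f r \<gamma> \<pi> x (t + s)) \<longlongrightarrow> real_value_fn f r \<gamma> \<pi> x) at_top"
    by (rule filterlim_compose[OF real_value_fn_tendsto[OF assms(1)]])
      (intro filterlim_tendsto_add_at_top[OF tendsto_const] filterlim_ident)
  ultimately show ?thesis
    by (intro tendsto_unique[OF trivial_limit_at_top_linorder]) 
qed

section \<open>Hamilton-Jacobi-Bellman residual and policy improvement\<close>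

lemma discounted_along_state_has_vector_derivative:
  fixes x :: "real ^ 'l"
  assumes "C1 v" "policy U \<pi>" "0 \<le> t"
  defines "X \<equiv> state f \<pi> x"
  shows "((\<lambda>t. \<gamma> powr t * v (X t)) has_vector_derivative
    \<gamma> powr t * (hamiltonian f r (X t) (\<pi> (X t)) (grad v (X t)) + ln \<gamma> * v (X t) - r (X t) (\<pi> (X t))))
    (at t within {0..})"
proof -
  let ?f = "f (X t) (\<pi> (X t))"
  have "(X has_vector_derivative ?f) (at t within {0..})"
    unfolding X_def using assms(2,3) by (rule state_has_vector_derivative)
  moreover have "(v has_derivative (\<lambda>h. h \<bullet> grad v (X t))) (at (X t))"
    using C1_GDERIV[OF assms(1)] unfolding gderiv_def .
  ultimately have "((\<lambda>t. v (X t)) has_derivative (\<lambda>h. (h *\<^sub>R ?f) \<bullet> grad v (X t))) (at t within {0..})"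
    unfolding has_vector_derivative_def by (rule has_derivative_compose)
  then have "((\<lambda>t. v (X t)) has_real_derivative grad v (X t) \<bullet> ?f) (at t within {0..})"
    unfolding has_field_derivative_def by (simp add: inner_commute mult.commute[of _ "_ \<bullet> _"])
  then show ?thesis
    unfolding has_real_derivative_iff_has_vector_derivative[symmetric] hamiltonian_def using discount
    by (auto intro!: derivative_eq_intros has_real_derivative_powr_exponent simp: algebra_simps)
qed

text \<open>Adding the running reward cancels the -r in the derivative above and leaves the residual
  h - \<alpha> v as integrand. The residual is zero in policy evaluation and nonnegative in policy
  improvement.\<close>

lemma discounted_along_state_has_integral:
  fixes x :: "real ^ 'l"
  assumes "C1 v" "policy U \<pi>" "0 \<le> T"
  defines "X \<equiv> state f \<pi> x"
  shows "((\<lambda>t. \<gamma> powr t * (hamiltonian f r (X t) (\<pi> (X t)) (grad v (X t)) + ln \<gamma> * v (X t)))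
    has_integral discounted_reward f r \<gamma> \<pi> x T + \<gamma> powr T * v (X T) - v x) {0..T}"
proof -
  have "((\<lambda>t. \<gamma> powr t * (hamiltonian f r (X t) (\<pi> (X t)) (grad v (X t)) + ln \<gamma> * v (X t) - r (X t) (\<pi> (X t))))
    has_integral \<gamma> powr T * v (X T) - \<gamma> powr 0 * v (X 0)) {0..T}"
    unfolding X_def using assms(1-3)
    by (intro fundamental_theorem_of_calculus has_vector_derivative_within_subset[OF discounted_along_state_has_vector_derivative]) auto
  from has_integral_add[OF has_integral_discounted_reward[OF assms(2), of x] this[unfolded X_def]]
  show ?thesis
    using discount state_0[OF assms(2)] by (simp add: X_def algebra_simps)
qed

text \<open>By the Bellman equation \<open>?D\<close> is constantly \<open>v x\<close>, so its
  derivative vanishes; at time 0 this derivative is the residual at \<open>x\<close>.\<close>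

lemma hamilton_jacobi_bellman:
  assumes adm: "admissible U f r \<gamma> \<pi>"
  defines "v \<equiv> real_value_fn f r \<gamma> \<pi>"
  shows "- ln \<gamma> * v x = hamiltonian f r x (\<pi> x) (grad v x)"
proof -
  have \<pi>: "policy U \<pi>" using adm by (simp add: admissible_def)
  have "C1 v"
    using adm admissible_VF_C1 unfolding v_def admissible_VFs_def by blast
  let ?X = "state f \<pi> x"
  let ?D = "\<lambda>t. discounted_reward f r \<gamma> \<pi> x t + \<gamma> powr t * v (?X t)"
  \<comment> \<open>Trajectories start at time 0, so only one-sided derivatives are available; on
    \<open>{0..1}\<close> they are still unique.\<close>
  have "(discounted_reward f r \<gamma> \<pi> x has_vector_derivative \<gamma> powr 0 * r (?X 0) (\<pi> (?X 0))) (at 0 within {0..1})"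
    unfolding discounted_reward_def[abs_def]
    by (intro integral_has_vector_derivative continuous_on_subset[OF continuous_on_policy_reward[OF \<pi>]]) auto
  moreover have "((\<lambda>t. \<gamma> powr t * v (?X t)) has_vector_derivative
      \<gamma> powr 0 * (hamiltonian f r (?X 0) (\<pi> (?X 0)) (grad v (?X 0)) + ln \<gamma> * v (?X 0) - r (?X 0) (\<pi> (?X 0)))) (at 0 within {0..1})"
    by (rule has_vector_derivative_within_subset[OF discounted_along_state_has_vector_derivative[OF \<open>C1 v\<close> \<pi>]]) auto
  ultimately have "(?D has_vector_derivative hamiltonian f r x (\<pi> x) (grad v x) + ln \<gamma> * v x) (at 0 within {0..1})"
    using has_vector_derivative_add discount by (fastforce simp: state_0[OF \<pi>])
  moreover have "(?D has_vector_derivative 0) (at 0 within {0..1})"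
    by (rule has_vector_derivative_transform[OF _ _ has_vector_derivative_const[of "v x"]])
      (use bellman[OF adm, of _ x] in \<open>auto simp: v_def\<close>)
  ultimately have "hamiltonian f r x (\<pi> x) (grad v x) + ln \<gamma> * v x = 0"
    using vector_derivative_unique_within_closed_interval[of 0 1 0 ?D] by auto
  then show ?thesis by simp
qed

text \<open>Both claims come from one sandwich: the reward of \<open>\<pi>'\<close> up to time T
  lies between v - \<gamma>^T B and B - \<gamma>^T B. In the limit its value lies between v and B,
  hence is finite and at least v.\<close>

lemma policy_improvement:
  assumes adm: "admissible U f r \<gamma> \<pi>"
    and max: "maximal_policy U f r (real_value_fn f r \<gamma> \<pi>) \<pi>'"
  shows "admissible U f r \<gamma> \<pi>'" and "real_value_fn f r \<gamma> \<pi> x \<le> real_value_fn f r \<gamma> \<pi>' x"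
proof -
  define v where "v = real_value_fn f r \<gamma> \<pi>"
  have \<pi>: "policy U \<pi>" "policy U \<pi>'"
    using adm max by (simp_all add: admissible_def maximal_policy_def)
  have "C1 v"
    using adm admissible_VF_C1 unfolding v_def admissible_VFs_def by blast
  obtain B where B0: "((\<lambda>t. \<gamma> powr t * B) \<longlongrightarrow> 0) at_top"
    and B: "\<And>\<pi> x t. policy U \<pi> \<Longrightarrow> 0 \<le> t \<Longrightarrow> discounted_reward f r \<gamma> \<pi> x t \<le> B - \<gamma> powr t * B"
    by (rule discounted_reward_bound) (rule that)
  have tendsto_B: "((\<lambda>t. B - \<gamma> powr t * B) \<longlongrightarrow> B) at_top"
    using tendsto_diff[OF tendsto_const[of B] B0] by simp
  have v_le: "v y \<le> B" for y
  proof (rule tendsto_le[OF _ tendsto_B])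
    show "(discounted_reward f r \<gamma> \<pi> y \<longlongrightarrow> v y) at_top"
      unfolding v_def using adm by (rule real_value_fn_tendsto)
    show "\<forall>\<^sub>F t in at_top. discounted_reward f r \<gamma> \<pi> y t \<le> B - \<gamma> powr t * B"
      using eventually_ge_at_top[of 0] by eventually_elim (simp add: B[OF \<pi>(1)])
  qed simp
  \<comment> \<open>The residual is zero for \<open>\<pi>\<close>, and \<open>\<pi>'\<close> can
    only increase the Hamiltonian.\<close>
  have drift: "0 \<le> hamiltonian f r y (\<pi>' y) (grad v y) + ln \<gamma> * v y" for y
  proof -
    have "\<pi> y \<in> U" using \<pi>(1) by (auto simp: policy_def)
    then have "hamiltonian f r y (\<pi> y) (grad v y) \<le> hamiltonian f r y (\<pi>' y) (grad v y)"
      using max unfolding maximal_policy_def argmax_on_def is_arg_max_linorder v_def by blast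
    then show ?thesis
      using hamilton_jacobi_bellman[OF adm, of y] by (simp add: v_def)
  qed
  have lower: "v y - \<gamma> powr T * B \<le> discounted_reward f r \<gamma> \<pi>' y T" if "0 \<le> T" for y T
  proof -
    have "0 \<le> discounted_reward f r \<gamma> \<pi>' y T + \<gamma> powr T * v (state f \<pi>' y T) - v y"
      by (rule has_integral_nonneg[OF discounted_along_state_has_integral[OF \<open>C1 v\<close> \<pi>(2) that]])
        (simp add: drift)
    \<comment> \<open>The bound v \<le> B replaces knowledge of v along the trajectory of
      \<open>\<pi>'\<close>, on which no boundary condition is assumed.\<close>
    then show ?thesis
      using mult_left_mono[OF v_le[of "state f \<pi>' y T"], of "\<gamma> powr T"] by simp
  qed
  have value_ge: "ereal (v y) \<le> value_fn f r \<gamma> \<pi>' y" for y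
  proof (rule tendsto_le[OF _ discounted_reward_tendsto[OF \<pi>(2)]])
    have "((\<lambda>T. v y - \<gamma> powr T * B) \<longlongrightarrow> v y) at_top"
      using tendsto_diff[OF tendsto_const[of "v y"] B0] by simp
    then show "((\<lambda>T. ereal (v y - \<gamma> powr T * B)) \<longlongrightarrow> ereal (v y)) at_top"
      by simp
    show "\<forall>\<^sub>F T in at_top. ereal (v y - \<gamma> powr T * B) \<le> ereal (discounted_reward f r \<gamma> \<pi>' y T)"
      using eventually_ge_at_top[of 0] by eventually_elim (simp add: lower)
  qed simp
  have value_le: "value_fn f r \<gamma> \<pi>' y \<le> ereal B" for y
  proof (rule tendsto_le[OF _ _ discounted_reward_tendsto[OF \<pi>(2)]])
    show "((\<lambda>T. ereal (B - \<gamma> powr T * B)) \<longlongrightarrow> ereal B) at_top"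
      using tendsto_B by simp
    show "\<forall>\<^sub>F T in at_top. ereal (discounted_reward f r \<gamma> \<pi>' y T) \<le> ereal (B - \<gamma> powr T * B)"
      using eventually_ge_at_top[of 0] by eventually_elim (simp add: B[OF \<pi>(2)])
  qed simp
  have finite: "\<bar>value_fn f r \<gamma> \<pi>' y\<bar> \<noteq> \<infinity>" for y
    using value_ge[of y] value_le[of y] by (cases "value_fn f r \<gamma> \<pi>' y") auto
  then show "admissible U f r \<gamma> \<pi>'"
    using \<pi>(2) by (simp add: admissible_def)
  show "real_value_fn f r \<gamma> \<pi> x \<le> real_value_fn f r \<gamma> \<pi>' x"
    using value_ge[of x] finite[of x] unfolding v_def[symmetric]
    by (cases "value_fn f r \<gamma> \<pi>' x") (auto simp: real_value_fn_def)
qed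

section \<open>Policy evaluation yields value functions\<close>

text \<open>With zero residual, reward up to T plus \<gamma>^T v(X_T) equals v x for every T \<ge>
  0. The boundary condition removes the last term as T grows.\<close>

lemma hamiltonian_equation_imp_value_fn:
  assumes adm: "admissible U f r \<gamma> \<pi>" and "C1 v"
    and eq: "\<And>x. - ln \<gamma> * v x = hamiltonian f r x (\<pi> x) (grad v x)"
    and lim: "\<And>x. ((\<lambda>t. \<gamma> powr t * v (state f \<pi> x t)) \<longlongrightarrow> 0) at_top"
  shows "v = real_value_fn f r \<gamma> \<pi>"
proof
  fix x
  have \<pi>: "policy U \<pi>" using adm by (simp add: admissible_def)
  have eq': "hamiltonian f r y (\<pi> y) (grad v y) + ln \<gamma> * v y = 0" for y
    using eq[of y] by simp
  have const: "v x = discounted_reward f r \<gamma> \<pi> x T + \<gamma> powr T * v (state f \<pi> x T)" if "0 \<le> T" for T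
    using discounted_along_state_has_integral[OF \<open>C1 v\<close> \<pi> that, of x] by (simp add: eq')
  have "\<forall>\<^sub>F T in at_top. discounted_reward f r \<gamma> \<pi> x T + \<gamma> powr T * v (state f \<pi> x T) = v x"
    using eventually_ge_at_top[of 0] by eventually_elim (simp flip: const)
  then have "((\<lambda>T. discounted_reward f r \<gamma> \<pi> x T + \<gamma> powr T * v (state f \<pi> x T)) \<longlongrightarrow> v x) at_top"
    by (rule tendsto_eventually)
  moreover have "((\<lambda>T. discounted_reward f r \<gamma> \<pi> x T + \<gamma> powr T * v (state f \<pi> x T))
      \<longlongrightarrow> real_value_fn f r \<gamma> \<pi> x + 0) at_top"
    by (intro tendsto_add real_value_fn_tendsto adm lim)
  ultimately show "v x = real_value_fn f r \<gamma> \<pi> x"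
    using tendsto_unique[OF trivial_limit_at_top_linorder] by fastforce
qed

text \<open>The equation links only times \<eta> apart. Restarting it at the state reached gives the
  identity at every horizon n \<eta>, and this sequence of horizons suffices for the limit.\<close>

lemma interval_equation_imp_value_fn:
  assumes adm: "admissible U f r \<gamma> \<pi>" and "0 < \<eta>"
    and eq: "\<And>x. v x = discounted_reward f r \<gamma> \<pi> x \<eta> + \<gamma> powr \<eta> * v (state f \<pi> x \<eta>)"
    and lim: "\<And>x. ((\<lambda>t. \<gamma> powr t * v (state f \<pi> x t)) \<longlongrightarrow> 0) at_top"
  shows "v = real_value_fn f r \<gamma> \<pi>"
proof
  fix x
  have \<pi>: "policy U \<pi>" using adm by (simp add: admissible_def)
  have iterated: "v x = discounted_reward f r \<gamma> \<pi> x (n * \<eta>) + \<gamma> powr (n * \<eta>) * v (state f \<pi> x (n * \<eta>))" for n :: nat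
  proof (induction n)
    case 0
    then show ?case
      using discount by (simp add: state_0[OF \<pi>] discounted_reward_def)
  next
    case (Suc n)
    have "0 \<le> n * \<eta>" "0 \<le> \<eta>" using \<open>0 < \<eta>\<close> by auto
    note add = discounted_reward_add[OF \<pi> this, of x] state_add[OF \<pi> this, of x]
    have *: "real (Suc n) * \<eta> = n * \<eta> + \<eta>"
      by (simp add: algebra_simps)
    show ?case
      unfolding * powr_add add(1) add(2)[symmetric]
      using Suc eq[of "state f \<pi> x (n * \<eta>)"] by (simp add: algebra_simps)
  qed
  have at_top: "filterlim (\<lambda>n. real n * \<eta>) at_top sequentially"
    using \<open>0 < \<eta>\<close> by (intro filterlim_at_top_mult_tendsto_pos[OF tendsto_const] filterlim_real_sequentially)
  have "((\<lambda>T. discounted_reward f r \<gamma> \<pi> x T + \<gamma> powr T * v (state f \<pi> x T))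
      \<longlongrightarrow> real_value_fn f r \<gamma> \<pi> x + 0) at_top"
    by (intro tendsto_add real_value_fn_tendsto adm lim)
  from filterlim_compose[OF this at_top]
  have "(\<lambda>n. v x) \<longlonglongrightarrow> real_value_fn f r \<gamma> \<pi> x"
    by (simp flip: iterated)
  then show "v x = real_value_fn f r \<gamma> \<pi> x"
    by (simp add: LIMSEQ_const_iff)
qed

text \<open>Admissibility of \<open>\<pi> i\<close> is assumed here because the boundary condition
  depends on it; the induction in the next lemma supplies it.\<close>

lemma policy_iteration_evaluation_improvement:
  assumes PI: "DPI U f r \<gamma> \<pi> v \<or> IPI U f r \<gamma> \<eta> fd fc \<pi> v"
    and bc: "boundary_condition U f r \<gamma> \<pi> v" and adm: "admissible U f r \<gamma> (\<pi> i)"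
  shows "v (Suc i) = real_value_fn f r \<gamma> (\<pi> i)" and "maximal_policy U f r (v (Suc i)) (\<pi> (Suc i))"
proof -
  have lim: "((\<lambda>t. \<gamma> powr t * v (Suc i) (state f (\<pi> i) x t)) \<longlongrightarrow> 0) at_top" for x
    using bc[unfolded boundary_condition_def, rule_format, of "Suc i"] adm by simp
  have "v (Suc i) = real_value_fn f r \<gamma> (\<pi> i) \<and> maximal_policy U f r (v (Suc i)) (\<pi> (Suc i))"
    using PI
  proof
    assume "DPI U f r \<gamma> \<pi> v"
    moreover have "1 \<le> Suc i" by simp
    ultimately have "C1 (v (Suc i))"
      "\<And>x. - ln \<gamma> * v (Suc i) x = hamiltonian f r x (\<pi> (Suc i - 1) x) (grad (v (Suc i)) x)"
      "maximal_policy U f r (v (Suc i)) (\<pi> (Suc i))"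
      unfolding DPI_def maximal_policy_def by blast+
    then show ?thesis
      using hamiltonian_equation_imp_value_fn[OF adm _ _ lim] unfolding diff_Suc_1 by blast
  next
    assume IPI: "IPI U f r \<gamma> \<eta> fd fc \<pi> v"
    moreover have "1 \<le> Suc i" by simp
    ultimately have "0 < \<eta>"
      "\<And>x. v (Suc i) x = discounted_reward f r \<gamma> (\<pi> (Suc i - 1)) x \<eta> + \<gamma> powr \<eta> * v (Suc i) (state f (\<pi> (Suc i - 1)) x \<eta>)"
      "policy U (\<pi> (Suc i))"
      "\<And>x. \<pi> (Suc i) x \<in> argmax_on U (\<lambda>u. r x u + grad (v (Suc i)) x \<bullet> fc x u)"
      unfolding IPI_def by blast+
    moreover have "argmax_on U (\<lambda>u. hamiltonian f r x u p) = argmax_on U (\<lambda>u. r x u + p \<bullet> fc x u)" for x p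
      using IPI by (intro hamiltonian_argmax_iff[where fd = fd]) (simp add: IPI_def)
    ultimately show ?thesis
      using interval_equation_imp_value_fn[OF adm _ _ lim] unfolding maximal_policy_def diff_Suc_1 by blast
  qed
  then show "v (Suc i) = real_value_fn f r \<gamma> (\<pi> i)"
    "maximal_policy U f r (v (Suc i)) (\<pi> (Suc i))" by auto
qed

lemma policy_iteration_admissible:
  assumes PI: "DPI U f r \<gamma> \<pi> v \<or> IPI U f r \<gamma> \<eta> fd fc \<pi> v"
    and bc: "boundary_condition U f r \<gamma> \<pi> v"
  shows "admissible U f r \<gamma> (\<pi> i)"
proof (induction i)
  case 0
  show ?case using PI unfolding DPI_def IPI_def by (elim disjE conjE)
next
  case (Suc i)
  note step = policy_iteration_evaluation_improvement[OF PI bc Suc]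
  show ?case
    by (rule policy_improvement(1)[OF Suc step(2)[unfolded step(1)]])
qed

end

section \<open>The metric for the policy iteration operator\<close>

theorem theorem4p5:
  fixes U :: "(real ^ 'm) set"
    and f :: "real ^ 'l \<Rightarrow> real ^ 'm \<Rightarrow> real ^ 'l"
    and r :: "real ^ 'l \<Rightarrow> real ^ 'm \<Rightarrow> real"
    and \<gamma> \<eta> :: real
    and fd :: "real ^ 'l \<Rightarrow> real ^ 'l"
    and fc :: "real ^ 'l \<Rightarrow> real ^ 'm \<Rightarrow> real ^ 'l"
    and \<pi> :: "nat \<Rightarrow> real ^ 'l \<Rightarrow> real ^ 'm"
    and v :: "nat \<Rightarrow> real ^ 'l \<Rightarrow> real"
    and \<T> :: "(real ^ 'l \<Rightarrow> real) \<Rightarrow> real ^ 'l \<Rightarrow> real"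
    and vstar :: "real ^ 'l \<Rightarrow> real"
  assumes "ct_rl_problem U f r \<gamma>"
    and "DPI U f r \<gamma> \<pi> v \<or> IPI U f r \<gamma> \<eta> fd fc \<pi> v"
    and "boundary_condition U f r \<gamma> \<pi> v"
    and "PI_operator U f r \<gamma> \<pi> \<T>"
    and "vstar \<in> admissible_VFs U f r \<gamma>" and "\<T> vstar = vstar"
    and "\<And>w. w \<in> admissible_VFs U f r \<gamma> \<Longrightarrow> \<T> w = w \<Longrightarrow> w = vstar"
  shows "\<exists>d. Metric_space (admissible_VFs U f r \<gamma>) d \<and>
             contraction_on (admissible_VFs U f r \<gamma>) d \<T> \<and>
             continuous_map (Metric_space.mtopology (admissible_VFs U f r \<gamma>) d)
                            (Metric_space.mtopology (admissible_VFs U f r \<gamma>) d) \<T> \<and>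
             limitin (Metric_space.mtopology (admissible_VFs U f r \<gamma>) d) v vstar sequentially"
proof -
  interpret ct_rl_problem U f r \<gamma> by fact
  let ?V = "admissible_VFs U f r \<gamma>"
  let ?w = "\<lambda>i. real_value_fn f r \<gamma> (\<pi> i)"
  note step = policy_iteration_evaluation_improvement[OF assms(2,3)]
  have adm: "admissible U f r \<gamma> (\<pi> i)" for i
    using assms(2,3) by (rule policy_iteration_admissible)
  have T_V: "\<T> \<in> ?V \<rightarrow> ?V"
    and T_step: "\<T> (?w i) = ?w (Suc i)" for i
    using assms(4) unfolding PI_operator_def by (blast, metis diff_Suc_1 le_add1 plus_1_eq_Suc)
  have T_other: "\<exists>\<pi>'. maximal_policy U f r w \<pi>' \<and> \<T> w = real_value_fn f r \<gamma> \<pi>'"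
    if "w \<in> ?V" "\<And>i. w \<noteq> ?w i" for w
    using assms(4) that unfolding PI_operator_def by blast
  have increasing: "w x \<le> \<T> w x" if w_V: "w \<in> ?V" for w x
  \<comment> \<open>On the generated value functions \<open>\<T>\<close> follows the given sequence,
    elsewhere a chosen maximal policy. Either way \<open>\<T> w\<close> is the value function of a
    maximal policy with respect to \<open>w\<close>.\<close>
  proof (cases "\<exists>i. w = ?w i")
    case True
    then obtain i where w: "w = ?w i" ..
    show ?thesis
      unfolding w T_step by (rule policy_improvement(2)[OF adm step(2)[OF adm, unfolded step(1)[OF adm]]])
  next
    case False
    then obtain \<pi>' where \<pi>': "maximal_policy U f r w \<pi>'" "\<T> w = real_value_fn f r \<gamma> \<pi>'"
      using T_other[OF w_V] by blast
    obtain \<rho> where "admissible U f r \<gamma> \<rho>" "w = real_value_fn f r \<gamma> \<rho>"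
      using w_V unfolding admissible_VFs_def by blast
    then show ?thesis
      using policy_improvement(2) \<pi>' by simp
  qed
  have iter_V: "(\<T> ^^ n) w \<in> ?V" if "w \<in> ?V" for w n
    using that T_V by (induction n) auto
  have iter_increasing: "w x \<le> (\<T> ^^ n) w x" if "w \<in> ?V" for w n x
  proof (induction n)
    case (Suc n)
    then show ?case
      using increasing[OF iter_V[OF that], of n x] by simp
  qed simp
  have no_periodic: "w = vstar" if w: "w \<in> ?V" and "0 < n" "(\<T> ^^ n) w = w" for w n
  proof -
    obtain m where "n = Suc m" using \<open>0 < n\<close> gr0_conv_Suc by blast
    then have "(\<T> ^^ m) (\<T> w) = w"
      using that(3) by (simp add: funpow_swap1)
    \<comment> \<open>Monotone growth is applied from \<open>\<T> w\<close> onwards, whose remaining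
      \<open>m\<close> iterations return to \<open>w\<close>.\<close>
    then have "\<T> w x \<le> w x" for x
      using iter_increasing[of "\<T> w" x m] T_V w by auto
    then have "\<T> w = w"
      using increasing[OF w] by (intro ext antisym)
    then show ?thesis using assms(7) w by blast
  qed
  have "\<exists>d. Metric_space ?V d \<and> contraction_on ?V d \<T>"
    using T_V assms(6) no_periodic by (rule contracting_metric_if_no_periodic_points)
  then obtain d where d: "Metric_space ?V d" "contraction_on ?V d \<T>"
    by blast
  interpret d: Metric_space ?V d by fact
  have "?w 0 \<in> ?V"
    using adm unfolding admissible_VFs_def by blast
  note iterates = d.contraction_iterates_limitin[OF T_V d(2) assms(5,6) this]
  \<comment> \<open>The iteration starts at \<open>v 1\<close>, the value function of
    \<open>\<pi> 0\<close>. As \<open>v 0\<close> is arbitrary, convergence is first shown for the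
    shifted sequence.\<close>
  have "(\<T> ^^ n) (?w 0) = v (Suc n)" for n
    unfolding step(1)[OF adm] by (induction n) (simp_all add: T_step)
  then have "limitin d.mtopology (\<lambda>n. v (Suc n)) vstar sequentially"
    using iterates by simp
  then have "limitin d.mtopology v vstar sequentially"
    using limitin_sequentially_offset_rev[of d.mtopology v 1 vstar] by simp
  with d d.contraction_continuous_map[OF T_V d(2)] show ?thesis by blast
qed

end
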